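(* Let $I\subset\mathbb R$ be an arbitrary interval, $\varepsilon_0>0$, $k\in\mathbb N_0$. If $\phi\in L^1_{loc}(I,X)$ and the difference $\Delta_h\phi\in C^k(I^{-h},X)$ for all $h\in(0,\varepsilon_0]$, then $\phi\in C^k(I,X)$.
   Context: $X$ is a Banach space. $\Delta_h\phi(t)=\phi(t+h)-\phi(t)$. If $I$ is one of $(\alpha,\beta)$, $(\alpha,\beta]$, $[\alpha,\beta)$, $[\alpha,\beta]$ with $-\infty\le\alpha<\beta\le\infty$, then $I^{-h}$ denotes respectively $(\alpha,\beta-h)$, $(\alpha,\beta-h]$, $[\alpha,\beta-h)$, $[\alpha,\beta-h]$ (so $I^{-h}=I$ if $\beta=\infty$). $C^k(I,X)$: functions $I\to X$ with continuous derivatives (in norm) up to order $k$ on $I$; $C^0=C$. $L^1_{loc}$ refers to functions $I\to X$ which are locally Bochner integrable on $I$ (actual functions, not equivalence classes). *)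

theory Defs
  imports "HOL-Analysis.Analysis"
begin

text \<open>
  The flags \<open>lc\<close> and \<open>rc\<close> say whether the left and the right endpoint
  belong to the interval.  An infinite endpoint is never a point of the interval, whatever its flag,
  as the members are real numbers.
\<close>

definition real_interval :: "bool \<Rightarrow> bool \<Rightarrow> ereal \<Rightarrow> ereal \<Rightarrow> real set" where
  "real_interval lc rc \<alpha> \<beta> =
     {t. (if lc then \<alpha> \<le> ereal t else \<alpha> < ereal t) \<and> (if rc then ereal t \<le> \<beta> else ereal t < \<beta>)}"

text \<open>
  With \<open>I = real_interval lc rc \<alpha> \<beta>\<close>, this is \<open>I\<close> with its right endpoint moved
  to \<open>\<beta> - h\<close>, where \<open>\<infinity> - h = \<infinity>\<close>; it is empty once \<open>h\<close> exceeds the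
  length of \<open>I\<close>.
\<close>

definition real_interval_shrink :: "bool \<Rightarrow> bool \<Rightarrow> ereal \<Rightarrow> ereal \<Rightarrow> real \<Rightarrow> real set" where
  "real_interval_shrink lc rc \<alpha> \<beta> h = real_interval lc rc \<alpha> (\<beta> - ereal h)"

lemma real_interval_shrink_infinity [simp]:
  "real_interval_shrink lc rc \<alpha> \<infinity> h = real_interval lc rc \<alpha> \<infinity>"
  by (simp add: real_interval_shrink_def)

lemma real_interval_shrink_iff:
  assumes "0 \<le> h"
  shows "t \<in> real_interval_shrink lc rc \<alpha> \<beta> h \<longleftrightarrow>
    t \<in> real_interval lc rc \<alpha> \<beta> \<and> t + h \<in> real_interval lc rc \<alpha> \<beta>"
  using assms unfolding real_interval_shrink_def real_interval_def
  by (cases \<alpha>; cases \<beta>; cases lc; cases rc) auto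

definition forward_difference :: "real \<Rightarrow> (real \<Rightarrow> 'a::real_normed_vector) \<Rightarrow> real \<Rightarrow> 'a" where
  "forward_difference h \<phi> t = \<phi> (t + h) - \<phi> t"

text \<open>
  \<open>D i\<close> is the \<open>i\<close>-th derivative on \<open>I\<close>; it is one-sided at an
  endpoint that belongs to \<open>I\<close>.  Values outside \<open>I\<close> are irrelevant.
\<close>

definition Ck_on :: "nat \<Rightarrow> real set \<Rightarrow> (real \<Rightarrow> 'a::real_normed_vector) \<Rightarrow> bool" where
  "Ck_on k I f \<longleftrightarrow>
     (\<exists>D. (\<forall>t\<in>I. D 0 t = f t) \<and>
          (\<forall>i<k. \<forall>t\<in>I. (D i has_vector_derivative D (Suc i) t) (at t within I)) \<and>
          (\<forall>i\<le>k. continuous_on I (D i)))"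

text \<open>
  The predicate \<^const>\<open>integrable\<close> is confined to second countable, i.e. separable, target
  spaces.  In a general Banach space, Bochner integrability asks for simple functions that converge
  to \<open>f\<close> almost everywhere (strong measurability) and in the mean.
\<close>

definition bochner_integrable :: "'a measure \<Rightarrow> ('a \<Rightarrow> 'b::real_normed_vector) \<Rightarrow> bool" where
  "bochner_integrable M f \<longleftrightarrow>
     (\<exists>s. (\<forall>i. Bochner_Integration.simple_bochner_integrable M (s i)) \<and>
          (AE x in M. (\<lambda>i. s i x) \<longlonglongrightarrow> f x) \<and>
          (\<lambda>i. \<integral>\<^sup>+x. ennreal (norm (f x - s i x)) \<partial>M) \<longlonglongrightarrow> 0)"

lemma integrable_imp_bochner_integrable:
  fixes f :: "'a \<Rightarrow> 'b::{banach, second_countable_topology}"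
  assumes "integrable M f"
  shows "bochner_integrable M f"
proof -
  have f [measurable]: "f \<in> borel_measurable M"
    and fin: "(\<integral>\<^sup>+x. norm (f x) \<partial>M) < \<infinity>"
    using assms by (auto simp: integrable_iff_bounded)
  obtain s where s: "\<And>i. simple_function M (s i)"
      "\<And>x. x \<in> space M \<Longrightarrow> (\<lambda>i. s i x) \<longlonglongrightarrow> f x"
      "\<And>i x. x \<in> space M \<Longrightarrow> dist (s i x) 0 \<le> 2 * dist (f x) 0"
    using borel_measurable_implies_sequence_metric[OF f, of 0] by metis
  have sm [measurable]: "\<And>i. s i \<in> borel_measurable M"
    using s(1) by (rule borel_measurable_simple_function)
  have bnd: "norm (s i x) \<le> 2 * norm (f x)" if "x \<in> space M" for i x
    using s(3)[OF that, of i] by simp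
  have fin2: "(\<integral>\<^sup>+x. ennreal (2 * norm (f x)) \<partial>M) < \<infinity>"
    using fin by (simp add: ennreal_mult nn_integral_cmult ennreal_mult_less_top)
  have "Bochner_Integration.simple_bochner_integrable M (s i)" for i
  proof (rule simple_bochner_integrableI_bounded[OF s(1)])
    have "(\<integral>\<^sup>+x. norm (s i x) \<partial>M) \<le> (\<integral>\<^sup>+x. ennreal (2 * norm (f x)) \<partial>M)"
      by (intro nn_integral_mono ennreal_leI bnd)
    then show "(\<integral>\<^sup>+x. norm (s i x) \<partial>M) < \<infinity>"
      using fin2 by (rule le_less_trans)
  qed
  moreover have "AE x in M. (\<lambda>i. s i x) \<longlonglongrightarrow> f x"
    using s(2) by simp
  moreover have "(\<lambda>i. \<integral>\<^sup>+x. ennreal (norm (f x - s i x)) \<partial>M) \<longlonglongrightarrow> 0"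
    by (rule nn_integral_dominated_convergence_norm[where w = "\<lambda>x. 2 * norm (f x)"])
       (use s(2) bnd fin2 in auto)
  ultimately show ?thesis
    unfolding bochner_integrable_def by blast
qed

lemma bochner_integrable_iff_integrable:
  fixes f :: "'a \<Rightarrow> 'b::{banach, second_countable_topology}"
  assumes "f \<in> borel_measurable M"
  shows "bochner_integrable M f \<longleftrightarrow> integrable M f"
proof
  assume "bochner_integrable M f"
  then show "integrable M f"
    unfolding bochner_integrable_def using integrableI_sequence[OF assms] by blast
qed (rule integrable_imp_bochner_integrable)

definition L1_loc :: "real set \<Rightarrow> (real \<Rightarrow> 'a::real_normed_vector) \<Rightarrow> bool" where
  "L1_loc I f \<longleftrightarrow> (\<forall>K. compact K \<and> K \<subseteq> I \<longrightarrow> bochner_integrable (lebesgue_on K) f)"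

end

theory Submission
  imports Defs
begin

text \<open>
  Measurability enters only through Lusin's property: a strongly measurable \<open>f\<close> is continuous on
  compact subsets \<open>C\<close> of almost full measure of every compact interval.  Everything else
  plays off the values of \<open>f\<close> near one point \<open>t\<close> against those near \<open>t + h\<close>, where the freedom
  in the choice of \<open>h\<close> is essential.  Write \<open>\<Delta>\<^sub>h f (t) = f (t + h) - f t\<close>; the
  hypothesis for positive \<open>h\<close> gives the same for all \<open>\<bar>h\<bar> \<le> \<epsilon>\<close>, on the set of
  all \<open>t\<close> with \<open>t, t + h \<in> I\<close>, so that points of \<open>I\<close> at either end
  need no separate treatment.

  \<^emph>\<open>Continuity\<close> (\<open>continuous_on_if_differences_continuous\<close>).  Suppose that \<open>u\<^sub>n \<rightarrow> 0\<close> while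
  \<open>f (t + u\<^sub>n)\<close> stays away from \<open>f t\<close>.  Take a Lusin set \<open>C\<close> of positive measure near
  \<open>t\<close>.  The points of \<open>C\<close> that the shift by \<open>u\<^sub>n\<close> moves out of \<open>C\<close> have
  small measure, so if \<open>u\<^sub>n\<close> tends to \<open>0\<close> fast enough, some \<open>x \<in> C\<close> has
  \<open>x + u\<^sub>n \<in> C\<close> for all \<open>n\<close>.  With \<open>h = x - t\<close>,
  \<open>f (t + u\<^sub>n) = f (x + u\<^sub>n) - \<Delta>\<^sub>h f (t + u\<^sub>n) \<rightarrow> f x - \<Delta>\<^sub>h f t = f t\<close>, a contradiction.

  \<^emph>\<open>Differentiability\<close> (\<open>differentiable_if_differences_differentiable\<close>).  Now \<open>f\<close> is continuous and
  the \<open>\<Delta>\<^sub>h f\<close> are differentiable.  The difference quotient of \<open>f\<close> at \<open>t + h\<close>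
  minus the one at \<open>t\<close> is the difference quotient of \<open>\<Delta>\<^sub>h f\<close> at \<open>t\<close>, which converges for
  every \<open>h\<close>.  By Baire's theorem these quotients are uniformly bounded for \<open>h\<close> in some interval
  \<open>J\<close>.  Averaged over \<open>h \<in> J\<close>, the quotients at \<open>t + h\<close> converge by the fundamental theorem of
  calculus, and the quotients of \<open>\<Delta>\<^sub>h f\<close> form a Cauchy family by dominated convergence.  Hence the
  quotients of \<open>f\<close> at \<open>t\<close> converge.

  \<^emph>\<open>Higher derivatives\<close> (\<open>Ck_on_if_differences_Ck_on\<close>).  The derivative \<open>f'\<close> is a pointwise limit of
  continuous functions, so it has Lusin's property, and \<open>\<Delta>\<^sub>h f'\<close> is the derivative of
  \<open>\<Delta>\<^sub>h f\<close>.  The first step makes \<open>f'\<close> continuous, and induction on \<open>k\<close> applies to it.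
\<close>

section \<open>Lusin's property\<close>

text \<open>
  The conclusion of Lusin's theorem is used in place of measurability: for a target space that is
  not separable it is the form in which strong measurability can be exploited, it holds for simple
  and for continuous functions, and it survives limits.
\<close>

definition lusin_on :: "real set \<Rightarrow> (real \<Rightarrow> 'a::metric_space) \<Rightarrow> bool" where
  "lusin_on A f \<longleftrightarrow>
     (\<forall>e>0. \<exists>C. compact C \<and> C \<subseteq> A \<and> continuous_on C f \<and> emeasure lebesgue (A - C) \<le> ennreal e)"

text \<open>
  The bookkeeping behind every small-exceptional-set argument below: the exceptional sets have
  measures summing to at most \<open>e\<close>, and compactness passes to the intersection.
\<close>

lemma compact_INT_almost_full:
  fixes A :: "real set" and C :: "nat \<Rightarrow> real set"
  assumes "compact A" and "e > 0"
    and C: "\<And>i. compact (C i)" "\<And>i. C i \<subseteq> A"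
    and small: "\<And>i. emeasure lebesgue (A - C i) \<le> ennreal (e * (1/2) ^ Suc i)"
  shows "compact (\<Inter>i. C i)" "(\<Inter>i. C i) \<subseteq> A" "emeasure lebesgue (A - (\<Inter>i. C i)) \<le> ennreal e"
proof -
  show "compact (\<Inter>i. C i)"
    using C(1) by (intro compact_Inter) auto
  show "(\<Inter>i. C i) \<subseteq> A"
    using C(2) by blast
  have meas: "range (\<lambda>i. A - C i) \<subseteq> sets lebesgue"
    using assms(1) C(1) by (auto intro!: sets.Diff dest: lmeasurable_compact)
  have "emeasure lebesgue (A - (\<Inter>i. C i)) = emeasure lebesgue (\<Union>i. A - C i)"
    by (rule arg_cong[where f = "emeasure lebesgue"]) auto
  also have "\<dots> \<le> (\<Sum>i. emeasure lebesgue (A - C i))"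
    by (rule emeasure_subadditive_countably[OF meas])
  also have "\<dots> \<le> (\<Sum>i. ennreal (e * (1/2) ^ Suc i))"
    by (intro suminf_le small) auto
  also have "\<dots> = ennreal e"
  proof -
    have "(\<lambda>i. e * (1/2) ^ Suc i) sums (e * 1)"
      by (intro sums_mult power_half_series)
    then show ?thesis
      using \<open>e > 0\<close> by (subst suminf_ennreal_eq[of _ e]) auto
  qed
  finally show "emeasure lebesgue (A - (\<Inter>i. C i)) \<le> ennreal e" .
qed

lemma lusin_on_continuous:
  assumes "compact A" "continuous_on A f"
  shows "lusin_on A f"
  using assms unfolding lusin_on_def by (auto intro!: exI[of _ A])

lemma compact_inner_approx:
  fixes A B :: "real set"
  assumes "compact A" "B \<in> sets lebesgue" "B \<subseteq> A" "e > 0"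
  obtains C where "compact C" "C \<subseteq> B" "emeasure lebesgue (B - C) \<le> ennreal e"
proof -
  obtain C where C: "closed C" "C \<subseteq> B" "emeasure lebesgue (B - C) < ennreal e"
    using sets_lebesgue_inner_closed[OF assms(2,4)] by metis
  have "compact C"
    using compact_Int_closed[OF assms(1) C(1)] C(2) assms(3) by (metis Int_absorb1 order_trans)
  then show ?thesis
    using that C by auto
qed

text \<open>
  Each of the finitely many level sets is approximated from inside by a compact set.  On the union of
  these disjoint closed pieces the function is locally constant.
\<close>

lemma lusin_on_simple_function:
  fixes f :: "real \<Rightarrow> 'a::metric_space"
  assumes "compact A" and f: "simple_function (lebesgue_on A) f"
  shows "lusin_on A f"
  unfolding lusin_on_def
proof (intro allI impI)
  fix e :: real
  assume "e > 0"
  have A: "A \<in> sets lebesgue"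
    using assms(1) lmeasurable_compact by blast
  have fin: "finite (f ` A)"
    using f by (simp add: simple_function_def)
  define n where "n = real (card (f ` A)) + 1"
  have "n > 0"
    by (simp add: n_def add_nonneg_pos)
  define L where "L v = {x \<in> A. f x = v}" for v
  have L: "L v \<in> sets lebesgue" if "v \<in> f ` A" for v
  proof -
    have "f -` {v} \<inter> A \<in> sets (lebesgue_on A)"
      using f that by (auto simp: simple_function_def)
    moreover have "f -` {v} \<inter> A = L v"
      by (auto simp: L_def)
    ultimately show ?thesis
      using A by (simp add: sets_restrict_space_iff)
  qed
  have "\<exists>C. compact C \<and> C \<subseteq> L v \<and> emeasure lebesgue (L v - C) \<le> ennreal (e / n)" if "v \<in> f ` A" for v
    using compact_inner_approx[OF assms(1) L[OF that], of "e / n"] \<open>e > 0\<close> \<open>n > 0\<close>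
    by (auto simp: L_def)
  then obtain C where C: "\<And>v. v \<in> f ` A \<Longrightarrow> compact (C v)" "\<And>v. v \<in> f ` A \<Longrightarrow> C v \<subseteq> L v"
     "\<And>v. v \<in> f ` A \<Longrightarrow> emeasure lebesgue (L v - C v) \<le> ennreal (e / n)"
    by metis
  let ?C = "\<Union>v\<in>f ` A. C v"
  have "continuous_on ?C f"
  proof (rule continuous_on_closed_Union[OF fin])
    fix v assume v: "v \<in> f ` A"
    show "closed (C v)"
      using C(1)[OF v] by (rule compact_imp_closed)
    show "continuous_on (C v) f"
      using C(2)[OF v] by (intro continuous_on_eq[OF continuous_on_const[of _ v]]) (auto simp: L_def)
  qed
  moreover have "compact ?C"
    using fin C(1) by (rule compact_UN)
  moreover have "?C \<subseteq> A"
    using C(2) by (auto simp: L_def)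
  moreover have "emeasure lebesgue (A - ?C) \<le> ennreal e"
  proof -
    have "emeasure lebesgue (A - ?C) \<le> emeasure lebesgue (\<Union>v\<in>f ` A. L v - C v)"
    proof (rule emeasure_mono)
      show "A - ?C \<subseteq> (\<Union>v\<in>f ` A. L v - C v)"
        by (auto simp: L_def)
      show "(\<Union>v\<in>f ` A. L v - C v) \<in> sets lebesgue"
        using fin L C(1) by (intro sets.finite_UN sets.Diff) (auto dest: lmeasurable_compact)
    qed
    also have "\<dots> \<le> (\<Sum>v\<in>f ` A. emeasure lebesgue (L v - C v))"
      using fin L C(1) by (intro emeasure_subadditive_finite) (auto intro!: sets.Diff dest: lmeasurable_compact)
    also have "\<dots> \<le> (\<Sum>v\<in>f ` A. ennreal (e / n))"
      by (intro sum_mono C(3))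
    also have "\<dots> = ennreal (real (card (f ` A)) * (e / n))"
      using \<open>e > 0\<close> \<open>n > 0\<close> by (subst ennreal_mult) (auto simp: ennreal_of_nat_eq_real_of_nat)
    also have "\<dots> \<le> ennreal e"
      using \<open>e > 0\<close> \<open>n > 0\<close> by (intro ennreal_leI) (auto simp: n_def field_simps)
    finally show ?thesis .
  qed
  ultimately show "\<exists>C. compact C \<and> C \<subseteq> A \<and> continuous_on C f \<and> emeasure lebesgue (A - C) \<le> ennreal e"
    by blast
qed

lemma lusin_on_common:
  fixes s :: "nat \<Rightarrow> real \<Rightarrow> 'a::metric_space"
  assumes "compact A" "e > 0" and s: "\<And>i. lusin_on A (s i)"
  obtains C where "compact C" "C \<subseteq> A" "\<And>i. continuous_on C (s i)" "emeasure lebesgue (A - C) \<le> ennreal e"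
proof -
  have "\<exists>C. compact C \<and> C \<subseteq> A \<and> continuous_on C (s i)
          \<and> emeasure lebesgue (A - C) \<le> ennreal (e * (1/2) ^ Suc i)" for i
    using s[of i] \<open>e > 0\<close> unfolding lusin_on_def by simp
  then obtain C where C: "\<And>i. compact (C i)" "\<And>i. C i \<subseteq> A" "\<And>i. continuous_on (C i) (s i)"
     "\<And>i. emeasure lebesgue (A - C i) \<le> ennreal (e * (1/2) ^ Suc i)"
    by metis
  note I = compact_INT_almost_full[OF assms(1,2) C(1,2,4)]
  show ?thesis
    by (rule that[OF I(1,2) _ I(3)]) (rule continuous_on_subset[OF C(3)], blast)
qed

text \<open>
  Egorov's theorem.  As the \<open>s i\<close> are continuous on \<open>A\<close>, the sets on which all late terms are within
  \<open>1 / (k + 1)\<close> of each other are closed, so that the good set comes out compact at once.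
\<close>

lemma egorov_compact:
  fixes s :: "nat \<Rightarrow> real \<Rightarrow> 'a::metric_space"
  assumes "compact A" "e > 0" and cont: "\<And>i. continuous_on A (s i)"
    and lim: "\<And>x. x \<in> A \<Longrightarrow> (\<lambda>i. s i x) \<longlonglongrightarrow> f x"
  obtains C where "compact C" "C \<subseteq> A" "uniform_limit C s f sequentially" "emeasure lebesgue (A - C) \<le> ennreal e"
proof -
  define E where "E k n = {x \<in> A. \<forall>i\<ge>n. \<forall>j\<ge>n. dist (s i x) (s j x) \<le> inverse (real (Suc k))}" for k n
  have A: "A \<in> lmeasurable"
    using assms(1) by (rule lmeasurable_compact)
  have E: "compact (E k n)" for k n
  proof -
    have "E k n = A \<inter> (\<Inter>i\<in>{n..}. \<Inter>j\<in>{n..}. {x \<in> A. dist (s i x) (s j x) \<le> inverse (real (Suc k))})"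
      by (auto simp: E_def)
    moreover have "closed {x \<in> A. dist (s i x) (s j x) \<le> inverse (real (Suc k))}" for i j
    proof -
      have "closed (A \<inter> (\<lambda>x. dist (s i x) (s j x)) -` {..inverse (real (Suc k))})"
        by (intro continuous_closed_preimage continuous_on_dist cont compact_imp_closed[OF assms(1)] closed_atMost)
      moreover have "A \<inter> (\<lambda>x. dist (s i x) (s j x)) -` {..inverse (real (Suc k))} =
          {x \<in> A. dist (s i x) (s j x) \<le> inverse (real (Suc k))}"
        by auto
      ultimately show ?thesis
        by metis
    qed
    ultimately show ?thesis
      using assms(1) by (simp add: compact_Int_closed closed_INT)
  qed
  have EA: "E k n \<subseteq> A" for k n
    by (auto simp: E_def)
  have "\<exists>n. emeasure lebesgue (A - E k n) \<le> ennreal (e * (1/2) ^ Suc k)" for k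
  proof -
    have "(\<lambda>n. emeasure lebesgue (A - E k n)) \<longlonglongrightarrow> emeasure lebesgue (\<Inter>n. A - E k n)"
    proof (rule Lim_emeasure_decseq)
      show "range (\<lambda>n. A - E k n) \<subseteq> sets lebesgue"
        using A E by (auto intro!: sets.Diff dest: lmeasurable_compact)
      show "decseq (\<lambda>n. A - E k n)"
        by (force simp: decseq_def E_def)
      show "emeasure lebesgue (A - E k n) \<noteq> \<infinity>" for n
        using fmeasurable.Diff[OF A lmeasurable_compact[OF E]] by (metis fmeasurableD2 infinity_ennreal_def)
    qed
    also have "(\<Inter>n. A - E k n) = {}"
    proof -
      have "\<exists>n. x \<in> E k n" if "x \<in> A" for x
      proof -
        have "Cauchy (\<lambda>i. s i x)"
          using lim[OF that] by (rule LIMSEQ_imp_Cauchy)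
        then obtain n where "\<forall>i\<ge>n. \<forall>j\<ge>n. dist (s i x) (s j x) < inverse (real (Suc k))"
          unfolding Cauchy_def by (metis inverse_positive_iff_positive of_nat_0_less_iff zero_less_Suc)
        then show ?thesis
          using that unfolding E_def by (auto intro: less_imp_le)
      qed
      then show ?thesis
        by auto
    qed
    finally have "(\<lambda>n. emeasure lebesgue (A - E k n)) \<longlonglongrightarrow> 0"
      by simp
    then have "\<forall>\<^sub>F n in sequentially. emeasure lebesgue (A - E k n) < ennreal (e * (1/2) ^ Suc k)"
      using \<open>e > 0\<close> by (intro order_tendstoD) auto
    then show ?thesis
      by (auto simp: eventually_sequentially intro: less_imp_le)
  qed
  then obtain n where n: "\<And>k. emeasure lebesgue (A - E k (n k)) \<le> ennreal (e * (1/2) ^ Suc k)"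
    by metis
  let ?C = "\<Inter>k. E k (n k)"
  note I = compact_INT_almost_full[OF assms(1,2), of "\<lambda>k. E k (n k)", OF E EA n]
  have "uniform_limit ?C s f sequentially"
  proof (rule uniform_limitI)
    fix d :: real
    assume "d > 0"
    then obtain k where k: "inverse (real (Suc k)) < d"
      using reals_Archimedean by blast
    have "dist (s i x) (f x) < d" if "i \<ge> n k" "x \<in> ?C" for i x
    proof -
      have x: "x \<in> A" "\<And>j. j \<ge> n k \<Longrightarrow> dist (s i x) (s j x) \<le> inverse (real (Suc k))"
        using that by (auto simp: E_def)
      have "dist (s i x) (f x) \<le> inverse (real (Suc k))"
        by (rule tendsto_upperbound[OF tendsto_dist[OF tendsto_const lim[OF x(1)]]])
           (use x(2) in \<open>auto simp: eventually_sequentially\<close>)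
      then show ?thesis
        using k by simp
    qed
    then show "\<forall>\<^sub>F i in sequentially. \<forall>x\<in>?C. dist (s i x) (f x) < d"
      unfolding eventually_sequentially by blast
  qed
  then show ?thesis
    using that I by blast
qed

text \<open>
  The good set is found in three steps, each losing at most \<open>e / 3\<close>: make all \<open>s i\<close> continuous, avoid the
  null set \<open>N\<close>, and make the convergence uniform.
\<close>

lemma lusin_on_AE_limit:
  fixes s :: "nat \<Rightarrow> real \<Rightarrow> 'a::metric_space"
  assumes A: "compact A" and s: "\<And>i. lusin_on A (s i)"
    and N: "N \<in> null_sets lebesgue" and lim: "\<And>x. x \<in> A - N \<Longrightarrow> (\<lambda>i. s i x) \<longlonglongrightarrow> f x"
  shows "lusin_on A f"
  unfolding lusin_on_def
proof (intro allI impI)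
  fix e :: real
  assume "e > 0"
  have meas: "C \<in> sets lebesgue" if "compact C" for C :: "real set"
    using that lmeasurable_compact by blast
  obtain B where B: "compact B" "B \<subseteq> A" "\<And>i. continuous_on B (s i)" "emeasure lebesgue (A - B) \<le> ennreal (e/3)"
    using lusin_on_common[where s = s, OF A _ s, of "e/3"] \<open>e > 0\<close> by (metis divide_pos_pos zero_less_numeral)
  have BN: "B - N \<in> sets lebesgue"
    using meas[OF B(1)] N by auto
  obtain D where D: "compact D" "D \<subseteq> B - N" "emeasure lebesgue (B - N - D) \<le> ennreal (e/3)"
    using compact_inner_approx[OF B(1) BN, of "e/3"] \<open>e > 0\<close> by auto
  have contD: "continuous_on D (s i)" for i
    by (rule continuous_on_subset[OF B(3)]) (use D(2) in blast)
  have limD: "(\<lambda>i. s i x) \<longlonglongrightarrow> f x" if "x \<in> D" for x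
    using that D(2) B(2) by (intro lim) blast
  obtain C where C: "compact C" "C \<subseteq> D" "uniform_limit C s f sequentially"
     "emeasure lebesgue (D - C) \<le> ennreal (e/3)"
    using egorov_compact[OF D(1) _ contD limD, of "e/3"] \<open>e > 0\<close> by auto
  have "continuous_on C f"
    using C(3) continuous_on_subset[OF contD C(2)]
    by (intro uniform_limit_theorem[OF _ C(3)]) auto
  moreover have "emeasure lebesgue (A - C) \<le> ennreal e"
  proof -
    have "emeasure lebesgue (A - C) \<le> emeasure lebesgue (((A - B) \<union> (B - N - D) \<union> (D - C)) \<union> N)"
      using meas A B(1) D(1) C(1) N by (intro emeasure_mono) auto
    also have "\<dots> = emeasure lebesgue ((A - B) \<union> (B - N - D) \<union> (D - C))"
      using meas A B(1) D(1) C(1) N by (intro emeasure_Un_null_set) auto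
    also have "\<dots> \<le> emeasure lebesgue (A - B) + emeasure lebesgue (B - N - D) + emeasure lebesgue (D - C)"
      using meas A B(1) D(1) C(1) N
      by (intro order_trans[OF emeasure_subadditive] add_right_mono emeasure_subadditive) auto
    also have "\<dots> \<le> ennreal (e/3) + ennreal (e/3) + ennreal (e/3)"
      by (intro add_mono B D C)
    also have "\<dots> = ennreal e"
      using \<open>e > 0\<close> by (simp flip: ennreal_plus)
    finally show ?thesis .
  qed
  ultimately show "\<exists>C. compact C \<and> C \<subseteq> A \<and> continuous_on C f \<and> emeasure lebesgue (A - C) \<le> ennreal e"
    using C B D by blast
qed

lemma bochner_integrable_imp_lusin_on:
  fixes f :: "real \<Rightarrow> 'a::real_normed_vector"
  assumes "compact A" "bochner_integrable (lebesgue_on A) f"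
  shows "lusin_on A f"
proof -
  obtain s where s: "\<And>i. Bochner_Integration.simple_bochner_integrable (lebesgue_on A) (s i)"
    and lim: "AE x in lebesgue_on A. (\<lambda>i. s i x) \<longlonglongrightarrow> f x"
    using assms(2) unfolding bochner_integrable_def by blast
  have A: "A \<in> sets lebesgue"
    using assms(1) lmeasurable_compact by blast
  from lim have "AE x in lebesgue. x \<in> A \<longrightarrow> (\<lambda>i. s i x) \<longlonglongrightarrow> f x"
    using A by (simp add: AE_restrict_space_iff)
  then obtain N where N: "N \<in> null_sets lebesgue" "{x. \<not> (x \<in> A \<longrightarrow> (\<lambda>i. s i x) \<longlonglongrightarrow> f x)} \<subseteq> N"
    by (auto simp: eventually_ae_filter)
  show ?thesis
  proof (rule lusin_on_AE_limit[OF assms(1) _ N(1)])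
    show "lusin_on A (s i)" for i
      using s[of i] lusin_on_simple_function[OF assms(1)]
      by (auto elim: Bochner_Integration.simple_bochner_integrable.cases)
    show "(\<lambda>i. s i x) \<longlonglongrightarrow> f x" if "x \<in> A - N" for x
      using that N(2) by blast
  qed
qed

section \<open>Continuity from continuous differences\<close>

text \<open>
  Points of \<open>C\<close> that a short shift moves out of \<open>C\<close> land in \<open>U - C\<close> for a fixed open \<open>U \<supseteq> C\<close> of
  nearly the same measure.
\<close>

lemma emeasure_shift_leaves_compact:
  fixes C :: "real set"
  assumes C: "compact C" and "e > 0"
  obtains d where "d > 0" "\<And>u. \<bar>u\<bar> < d \<Longrightarrow> emeasure lebesgue {x \<in> C. x + u \<notin> C} \<le> ennreal e"
proof -
  have Cm: "C \<in> sets lebesgue"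
    using C lmeasurable_compact by blast
  obtain U where U: "open U" "C \<subseteq> U" "U - C \<in> lmeasurable" "emeasure lebesgue (U - C) < ennreal e"
    using sets_lebesgue_outer_open[OF Cm \<open>e > 0\<close>] by metis
  obtain d where d: "d > 0" "(\<Union>x\<in>C. ball x d) \<subseteq> U"
    using compact_subset_open_imp_ball_epsilon_subset[OF C U(1,2)] .
  have "emeasure lebesgue {x \<in> C. x + u \<notin> C} \<le> ennreal e" if u: "\<bar>u\<bar> < d" for u
  proof -
    have "emeasure lebesgue {x \<in> C. x + u \<notin> C} = emeasure lebesgue ((\<lambda>x. 1 *\<^sub>R x + u) ` {x \<in> C. x + u \<notin> C})"
      by (subst emeasure_lebesgue_affine) auto
    also have "\<dots> \<le> emeasure lebesgue (U - C)"
    proof (rule emeasure_mono)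
      show "(\<lambda>x. 1 *\<^sub>R x + u) ` {x \<in> C. x + u \<notin> C} \<subseteq> U - C"
        using d(2) u by (force simp: dist_real_def)
    qed (use U(3) in auto)
    finally show ?thesis
      using U(4) by simp
  qed
  with d(1) show ?thesis
    by (rule that)
qed

text \<open>
  As \<open>t\<close> may be an end of \<open>I\<close>, the interval \<open>{c..d}\<close> is placed to one side of it.  In the sequel
  \<open>t + h\<close> ranges over \<open>{c..d}\<close>, where two-sided arguments are available.
\<close>

lemma interval_near_point:
  fixes I :: "real set"
  assumes I: "is_interval I" "a \<in> I" "b \<in> I" "a < b" and t: "t \<in> I" and "e > 0"
  obtains c d where "c < d" "{c..d} \<subseteq> interior I" "\<And>x. x \<in> {c..d} \<Longrightarrow> \<bar>x - t\<bar> \<le> e"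
proof -
  have in_interior: "{c..d} \<subseteq> interior I" if "u \<in> I" "v \<in> I" "u < c" "d < v" for c d u v
  proof -
    have "{u<..<v} \<subseteq> I"
      using mem_is_interval_1_I[OF I(1) that(1,2)] by auto
    then have "{u<..<v} \<subseteq> interior I"
      by (rule interior_maximal) simp
    then show ?thesis
      using that by fastforce
  qed
  show ?thesis
  proof (cases "t < b")
    case True
    define m where "m = min e (b - t)"
    have "m > 0" "m \<le> e" "m \<le> b - t"
      using True \<open>e > 0\<close> by (auto simp: m_def)
    then show ?thesis
      by (intro that[of "t + m/3" "t + m/2"] in_interior[OF t I(3)]) auto
  next
    case False
    define m where "m = min e (t - a)"
    have "m > 0" "m \<le> e" "m \<le> t - a"
      using False I(4) \<open>e > 0\<close> by (auto simp: m_def)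
    then show ?thesis
      by (intro that[of "t - m/2" "t - m/3"] in_interior[OF I(2) t]) auto
  qed
qed

text \<open>
  Continuity at \<open>t\<close> is transferred from the restriction of \<open>f\<close> to a Lusin set \<open>C\<close>: the increments
  \<open>u n\<close> that witness a discontinuity at \<open>t\<close> are made to keep a common point \<open>x\<close> inside \<open>C\<close>, and the
  difference with \<open>h = x - t\<close> carries the convergence at \<open>x\<close> over to \<open>t\<close>.
\<close>

lemma continuous_on_if_differences_continuous:
  fixes f :: "real \<Rightarrow> 'a::real_normed_vector"
  assumes I: "is_interval I" "a \<in> I" "b \<in> I" "a < b" and "\<epsilon> > 0"
    and diff: "\<And>h. \<bar>h\<bar> \<le> \<epsilon> \<Longrightarrow> continuous_on {t \<in> I. t + h \<in> I} (forward_difference h f)"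
    and lusin: "\<And>c d. {c..d} \<subseteq> interior I \<Longrightarrow> lusin_on {c..d} f"
  shows "continuous_on I f"
proof (rule ccontr)
  assume "\<not> continuous_on I f"
  then obtain t e where t: "t \<in> I" and "e > 0"
    and far: "\<And>r. r > 0 \<Longrightarrow> \<exists>x\<in>I. dist x t < r \<and> e \<le> dist (f x) (f t)"
    unfolding continuous_on_iff by (meson not_less)
  obtain c d where cd: "c < d" "{c..d} \<subseteq> interior I" "\<And>x. x \<in> {c..d} \<Longrightarrow> \<bar>x - t\<bar> \<le> \<epsilon>"
    using interval_near_point[OF I t \<open>\<epsilon> > 0\<close>] by metis
  define \<mu> where "\<mu> = (d - c) / 3"
  have "\<mu> > 0"
    using cd(1) by (simp add: \<mu>_def)
  obtain C where C: "compact C" "C \<subseteq> {c..d}" "continuous_on C f" "emeasure lebesgue ({c..d} - C) \<le> ennreal \<mu>"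
    using lusin[OF cd(2)] \<open>\<mu> > 0\<close> unfolding lusin_on_def by metis
  have Cm: "C \<in> sets lebesgue"
    using C(1) lmeasurable_compact by blast
  \<comment> \<open>the increments \<open>u n\<close> are taken so small that the exceptional sets have measures summing to at most \<open>\<mu>\<close>\<close>
  have "\<exists>u. \<bar>u\<bar> < 1 / real (Suc n) \<and> t + u \<in> I \<and> e \<le> dist (f (t + u)) (f t)
          \<and> emeasure lebesgue {x \<in> C. x + u \<notin> C} \<le> ennreal (\<mu> * (1/2) ^ Suc n)" for n
  proof -
    obtain r where r: "r > 0" "\<And>u. \<bar>u\<bar> < r \<Longrightarrow> emeasure lebesgue {x \<in> C. x + u \<notin> C} \<le> ennreal (\<mu> * (1/2) ^ Suc n)"
      using emeasure_shift_leaves_compact[OF C(1), of "\<mu> * (1/2) ^ Suc n"] \<open>\<mu> > 0\<close> by auto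
    obtain x where "x \<in> I" "dist x t < min r (1 / real (Suc n))" "e \<le> dist (f x) (f t)"
      using far[of "min r (1 / real (Suc n))"] r(1) by auto
    then show ?thesis
      using r(2)[of "x - t"] by (intro exI[of _ "x - t"]) (auto simp: dist_real_def)
  qed
  then have "\<exists>u. \<forall>n. \<bar>u n\<bar> < 1 / real (Suc n) \<and> t + u n \<in> I \<and> e \<le> dist (f (t + u n)) (f t)
          \<and> emeasure lebesgue {x \<in> C. x + u n \<notin> C} \<le> ennreal (\<mu> * (1/2) ^ Suc n)"
    by (intro choice allI)
  then obtain u where u: "\<And>n. \<bar>u n\<bar> < 1 / real (Suc n)" "\<And>n. t + u n \<in> I"
     "\<And>n. e \<le> dist (f (t + u n)) (f t)"
     "\<And>n. emeasure lebesgue {x \<in> C. x + u n \<notin> C} \<le> ennreal (\<mu> * (1/2) ^ Suc n)"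
    by blast
  have u0: "u \<longlonglongrightarrow> 0"
    by (rule LIMSEQ_norm_0) (use u(1) in simp)
  define S where "S n = C \<inter> (\<lambda>x. x - u n) ` C" for n
  have S_iff: "x \<in> S n \<longleftrightarrow> x \<in> C \<and> x + u n \<in> C" for x n
    by (force simp: S_def)
  have S: "compact (S n)" "S n \<subseteq> C" "emeasure lebesgue (C - S n) \<le> ennreal (\<mu> * (1/2) ^ Suc n)" for n
  proof -
    show "compact (S n)"
      unfolding S_def using C(1) by (intro compact_Int compact_continuous_image continuous_intros)
    show "S n \<subseteq> C"
      by (auto simp: S_iff)
    have "C - S n = {x \<in> C. x + u n \<notin> C}"
      by (auto simp: S_iff)
    then show "emeasure lebesgue (C - S n) \<le> ennreal (\<mu> * (1/2) ^ Suc n)"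
      using u(4) by simp
  qed
  \<comment> \<open>otherwise \<open>C\<close> and \<open>{c..d} - C\<close> would each have at most a third of the measure of \<open>{c..d}\<close>\<close>
  have "(\<Inter>n. S n) \<noteq> {}"
  proof
    assume "(\<Inter>n. S n) = {}"
    then have small: "emeasure lebesgue C \<le> ennreal \<mu>"
      using compact_INT_almost_full(3)[OF C(1) \<open>\<mu> > 0\<close> S] by simp
    have "ennreal (d - c) = emeasure lebesgue {c..d}"
      using cd(1) by simp
    also have "\<dots> = emeasure lebesgue (C \<union> ({c..d} - C))"
      using C(2) by (intro arg_cong[where f = "emeasure lebesgue"]) auto
    also have "\<dots> \<le> emeasure lebesgue C + emeasure lebesgue ({c..d} - C)"
      using Cm by (intro emeasure_subadditive) auto
    also have "\<dots> \<le> ennreal \<mu> + ennreal \<mu>"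
      by (intro add_mono small C)
    also have "\<dots> = ennreal (2 * \<mu>)"
      using \<open>\<mu> > 0\<close> by (simp flip: ennreal_plus)
    finally show False
      using cd(1) by (simp add: \<mu>_def ennreal_le_iff2)
  qed
  then obtain x where x: "\<And>n. x \<in> C" "\<And>n. x + u n \<in> C"
    using S_iff by fastforce
  define h where "h = x - t"
  have xI: "C \<subseteq> I"
    using C(2) cd(2) interior_subset by blast
  have h: "\<bar>h\<bar> \<le> \<epsilon>"
    using cd(3)[of x] x(1) C(2) by (auto simp: h_def)
  have "(\<lambda>n. f (x + u n)) \<longlonglongrightarrow> f x"
    using x(1,2) tendsto_add[OF tendsto_const u0, of x]
    by (intro continuous_on_tendsto_compose[OF C(3)]) auto
  moreover have "(\<lambda>n. forward_difference h f (t + u n)) \<longlonglongrightarrow> forward_difference h f t"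
  proof (rule continuous_on_tendsto_compose[OF diff[OF h]])
    show "(\<lambda>n. t + u n) \<longlonglongrightarrow> t"
      using tendsto_add[OF tendsto_const u0, of t] by simp
    show "t \<in> {t \<in> I. t + h \<in> I}"
      using t x(1) xI by (auto simp: h_def)
    have "t + u n + h \<in> I" for n
      using x(2)[of n] xI by (auto simp: h_def algebra_simps)
    then show "\<forall>\<^sub>F n in sequentially. t + u n \<in> {t \<in> I. t + h \<in> I}"
      using u(2) by simp
  qed
  ultimately have "(\<lambda>n. f (x + u n) - forward_difference h f (t + u n)) \<longlonglongrightarrow> f x - forward_difference h f t"
    by (rule tendsto_diff)
  then have "(\<lambda>n. f (t + u n)) \<longlonglongrightarrow> f t"
    by (simp add: forward_difference_def h_def algebra_simps)
  from tendsto_dist[OF this tendsto_const[of "f t"]]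
  have "(\<lambda>n. dist (f (t + u n)) (f t)) \<longlonglongrightarrow> 0"
    by simp
  then have "e \<le> 0"
    by (rule tendsto_lowerbound) (use u(3) in auto)
  then show False
    using \<open>e > 0\<close> by simp
qed

section \<open>Differentiability from differentiable differences\<close>

text \<open>
  Baire's theorem: the complements of the \<open>F n\<close> in \<open>{p..q}\<close> cannot all be dense, as their
  intersection is empty.
\<close>

lemma closed_cover_contains_interval:
  fixes F :: "nat \<Rightarrow> real set"
  assumes "p < q" and F: "\<And>n. closed (F n)" and cover: "{p..q} \<subseteq> (\<Union>n. F n)"
  obtains n p' q' where "p' < q'" "{p'..q'} \<subseteq> {p..q}" "{p'..q'} \<subseteq> F n"
proof -
  let ?S = "{p..q}"
  have "\<exists>n. \<not> ?S \<subseteq> closure (?S - F n)"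
  proof (rule ccontr)
    assume dense: "\<not> ?thesis"
    have "?S \<subseteq> closure (\<Inter>(range (\<lambda>n. ?S - F n)))"
    proof (rule Baire)
      fix T assume "T \<in> range (\<lambda>n. ?S - F n)"
      then obtain n where n: "T = ?S - F n"
        by blast
      have "openin (top_of_set ?S) (?S \<inter> (- F n))"
        using F[of n] by (intro openin_open_Int) auto
      then show "openin (top_of_set ?S) T \<and> ?S \<subseteq> closure T"
        using dense n by (auto simp: Diff_eq)
    qed auto
    moreover have "(\<Inter>(range (\<lambda>n. ?S - F n))) = {}"
      using cover by auto
    ultimately have "?S \<subseteq> {}"
      by (metis closure_empty)
    then show False
      using \<open>p < q\<close> by simp
  qed
  then obtain n x where x: "x \<in> ?S" "x \<notin> closure (?S - F n)"
    by blast
  then obtain r where r: "r > 0" "\<And>y. y \<in> ?S \<Longrightarrow> dist y x < r \<Longrightarrow> y \<in> F n"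
    unfolding closure_approachable by blast
  show ?thesis
  proof (rule that)
    show "max p (x - r/2) < min q (x + r/2)" "{max p (x - r/2)..min q (x + r/2)} \<subseteq> {p..q}"
      using x(1) r(1) \<open>p < q\<close> by auto
    show "{max p (x - r/2)..min q (x + r/2)} \<subseteq> F n"
      using r by (auto simp: dist_real_def)
  qed
qed

text \<open>
  Comparing two sequences with the same limit \<open>g\<close>, instead of one sequence with \<open>g\<close>, reduces vector-valued
  integrands to real ones: dominated convergence applies to \<open>norm (u n x - v n x)\<close>, which tends to \<open>0\<close>.
\<close>

lemma integral_diff_tendsto_0:
  fixes u v :: "nat \<Rightarrow> real \<Rightarrow> 'a::banach"
  assumes cont: "\<And>n. continuous_on {p..q} (u n)" "\<And>n. continuous_on {p..q} (v n)"
    and bound: "\<And>n x. x \<in> {p..q} \<Longrightarrow> norm (u n x) \<le> M" "\<And>n x. x \<in> {p..q} \<Longrightarrow> norm (v n x) \<le> M"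
    and lim: "\<And>x. x \<in> {p..q} \<Longrightarrow> (\<lambda>n. u n x) \<longlonglongrightarrow> g x" "\<And>x. x \<in> {p..q} \<Longrightarrow> (\<lambda>n. v n x) \<longlonglongrightarrow> g x"
  shows "(\<lambda>n. integral {p..q} (u n) - integral {p..q} (v n)) \<longlonglongrightarrow> 0"
proof -
  have "(\<lambda>n. integral {p..q} (\<lambda>x. norm (u n x - v n x))) \<longlonglongrightarrow> integral {p..q} (\<lambda>x. 0::real)"
  proof (rule dominated_convergence(2)[where h = "\<lambda>x. 2 * M"])
    show "(\<lambda>x. norm (u n x - v n x)) integrable_on {p..q}" for n
      by (intro integrable_continuous_interval continuous_intros cont)
    show "norm (norm (u n x - v n x)) \<le> 2 * M" if "x \<in> {p..q}" for n x
      using norm_triangle_ineq4[of "u n x" "v n x"] bound(1)[OF that, of n] bound(2)[OF that, of n] by simp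
    show "(\<lambda>n. norm (u n x - v n x)) \<longlonglongrightarrow> 0" if "x \<in> {p..q}" for x
      using tendsto_norm[OF tendsto_diff[OF lim(1)[OF that] lim(2)[OF that]]] by simp
  qed (auto intro: integrable_continuous_interval)
  moreover have "norm (integral {p..q} (u n) - integral {p..q} (v n)) \<le> integral {p..q} (\<lambda>x. norm (u n x - v n x))" for n
  proof -
    have "integral {p..q} (u n) - integral {p..q} (v n) = integral {p..q} (\<lambda>x. u n x - v n x)"
      by (intro Henstock_Kurzweil_Integration.integral_diff[symmetric] integrable_continuous_interval cont)
    then show ?thesis
      by (auto intro!: integral_norm_bound_integral integrable_continuous_interval continuous_intros cont)
  qed
  ultimately show ?thesis
    unfolding integral_0 by (rule Lim_null_comparison[OF always_eventually[OF allI], rotated])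
qed

lemma has_vector_derivative_within_iff_quotient:
  "(f has_vector_derivative L) (at t within S) \<longleftrightarrow>
     ((\<lambda>y. (f y - f t) /\<^sub>R (y - t)) \<longlongrightarrow> L) (at t within S)"
proof -
  have "(f has_vector_derivative L) (at t within S) \<longleftrightarrow>
     ((\<lambda>y. norm ((f y - f t) - (y - t) *\<^sub>R L) / norm (y - t)) \<longlongrightarrow> 0) (at t within S)"
    unfolding has_vector_derivative_def has_derivative_iff_norm
    by (simp add: bounded_linear_scaleR_left)
  also have "\<dots> \<longleftrightarrow> ((\<lambda>y. norm ((f y - f t) /\<^sub>R (y - t) - L)) \<longlongrightarrow> 0) (at t within S)"
  proof (rule filterlim_cong[OF refl refl])
    have "norm ((f y - f t) - (y - t) *\<^sub>R L) / norm (y - t) = norm ((f y - f t) /\<^sub>R (y - t) - L)" if "y \<noteq> t" for y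
    proof -
      have "(f y - f t) /\<^sub>R (y - t) - L = ((f y - f t) - (y - t) *\<^sub>R L) /\<^sub>R (y - t)"
        using that by (simp add: scaleR_diff_right)
      then show ?thesis
        by (simp add: divide_inverse_commute)
    qed
    then show "\<forall>\<^sub>F y in at t within S. norm ((f y - f t) - (y - t) *\<^sub>R L) / norm (y - t) =
        norm ((f y - f t) /\<^sub>R (y - t) - L)"
      by (auto simp: eventually_at_filter)
  qed
  also have "\<dots> \<longleftrightarrow> ((\<lambda>y. (f y - f t) /\<^sub>R (y - t)) \<longlongrightarrow> L) (at t within S)"
    using tendsto_norm_zero_iff[of "\<lambda>y. (f y - f t) /\<^sub>R (y - t) - L"] by (simp add: LIM_zero_iff)
  finally show ?thesis .
qed

text \<open>
  Cauchy's criterion in sequential form, which suits dominated convergence.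
\<close>

lemma tendsto_within_if_sequences_merge:
  fixes q :: "real \<Rightarrow> 'a::banach"
  assumes merge: "\<And>y z. (\<And>n. y n \<in> S - {t}) \<Longrightarrow> y \<longlonglongrightarrow> t \<Longrightarrow> (\<And>n. z n \<in> S - {t}) \<Longrightarrow> z \<longlonglongrightarrow> t
      \<Longrightarrow> (\<lambda>n. q (y n) - q (z n)) \<longlonglongrightarrow> 0"
  shows "\<exists>L. (q \<longlongrightarrow> L) (at t within S)"
proof (cases "at t within S = bot")
  case True
  then show ?thesis
    by simp
next
  case False
  have "\<exists>P. eventually P (at t within S) \<and> (\<forall>x y. P x \<and> P y \<longrightarrow> dist (q x) (q y) < e)" if "e > 0" for e
  proof (rule ccontr)
    assume neg: "\<not> ?thesis"
    have "\<exists>y z. y \<in> S - {t} \<and> z \<in> S - {t} \<and> dist y t < 1 / real (Suc n) \<and> dist z t < 1 / real (Suc n)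
        \<and> e \<le> dist (q y) (q z)" for n
    proof -
      let ?P = "\<lambda>y. y \<in> S \<and> y \<noteq> t \<and> dist y t < 1 / real (Suc n)"
      have "eventually ?P (at t within S)"
        unfolding eventually_at by (intro exI[of _ "1 / real (Suc n)"]) auto
      then obtain y z where "?P y" "?P z" "\<not> dist (q y) (q z) < e"
        using neg by blast
      then show ?thesis
        by (intro exI[of _ y] exI[of _ z]) auto
    qed
    then have "\<exists>y. \<forall>n. \<exists>z. y n \<in> S - {t} \<and> z \<in> S - {t} \<and> dist (y n) t < 1 / real (Suc n) \<and> dist z t < 1 / real (Suc n)
        \<and> e \<le> dist (q (y n)) (q z)"
      by (intro choice allI)
    then obtain y where "\<forall>n. \<exists>z. y n \<in> S - {t} \<and> z \<in> S - {t} \<and> dist (y n) t < 1 / real (Suc n) \<and> dist z t < 1 / real (Suc n)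
        \<and> e \<le> dist (q (y n)) (q z)"
      by blast
    then have "\<exists>z. \<forall>n. y n \<in> S - {t} \<and> z n \<in> S - {t} \<and> dist (y n) t < 1 / real (Suc n) \<and> dist (z n) t < 1 / real (Suc n)
        \<and> e \<le> dist (q (y n)) (q (z n))"
      by (intro choice)
    then obtain z where yz: "\<And>n. y n \<in> S - {t}" "\<And>n. z n \<in> S - {t}"
        "\<And>n. dist (y n) t < 1 / real (Suc n)" "\<And>n. dist (z n) t < 1 / real (Suc n)"
        "\<And>n. e \<le> dist (q (y n)) (q (z n))"
      by blast
    have lim: "w \<longlonglongrightarrow> t" if "\<And>n. dist (w n) t < 1 / real (Suc n)" for w :: "nat \<Rightarrow> real"
    proof -
      have "(\<lambda>n. w n - t) \<longlonglongrightarrow> 0"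
        by (rule LIMSEQ_norm_0) (use that in \<open>simp add: dist_norm\<close>)
      then show ?thesis
        by (simp add: LIM_zero_iff)
    qed
    have "(\<lambda>n. norm (q (y n) - q (z n))) \<longlonglongrightarrow> 0"
      using merge[OF yz(1) lim[OF yz(3)] yz(2) lim[OF yz(4)]] by (rule tendsto_norm_zero)
    then have "e \<le> 0"
      by (rule tendsto_lowerbound) (use yz(5) in \<open>auto simp: dist_norm\<close>)
    then show False
      using \<open>e > 0\<close> by simp
  qed
  then have "cauchy_filter (filtermap q (at t within S))"
    unfolding cauchy_filter_metric_filtermap by blast
  moreover have "complete (UNIV :: 'a set)"
    by (rule complete_UNIV)
  ultimately have "\<exists>L. filtermap q (at t within S) \<le> nhds L"
    using False by (auto simp: complete_uniform filtermap_bot_iff)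
  then show ?thesis
    by (simp add: filterlim_def)
qed

text \<open>
  In the proof, \<open>quot y\<close> is the difference quotient of \<open>f\<close> at \<open>t\<close>, \<open>Q y h\<close> that of
  \<open>forward_difference h f\<close> at \<open>t\<close>, and \<open>B y\<close> the integral over \<open>h \<in> {p'..q'}\<close> of the difference
  quotients of \<open>f\<close> at \<open>t + h\<close>.  The identity \<open>(q' - p') *\<^sub>R quot y = B y - integral {p'..q'} (Q y)\<close>
  transfers convergence from the right to the left.
\<close>

lemma differentiable_if_differences_differentiable:
  fixes f :: "real \<Rightarrow> 'a::banach"
  assumes I: "is_interval I" "a \<in> I" "b \<in> I" "a < b" and "\<epsilon> > 0" and t: "t \<in> I"
    and f: "continuous_on I f"
    and diff: "\<And>h. \<bar>h\<bar> \<le> \<epsilon> \<Longrightarrow> t + h \<in> I \<Longrightarrow>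
        \<exists>g. (forward_difference h f has_vector_derivative g) (at t within {t \<in> I. t + h \<in> I})"
  shows "\<exists>L. (f has_vector_derivative L) (at t within I)"
proof -
  obtain c d where cd: "c < d" "{c..d} \<subseteq> interior I" "\<And>x. x \<in> {c..d} \<Longrightarrow> \<bar>x - t\<bar> \<le> \<epsilon>"
    using interval_near_point[OF I t \<open>\<epsilon> > 0\<close>] by metis
  have cdI: "x \<in> I" if "c \<le> x" "x \<le> d" for x
    using cd(2) interior_subset that by (metis atLeastAtMost_iff subsetD)
  \<comment> \<open>\<open>t + h\<close> is confined to the middle third of \<open>{c..d}\<close>, which leaves room \<open>m\<close> for the increment \<open>y - t\<close>\<close>
  define m where "m = (d - c) / 3"
  have "m > 0"
    using cd(1) by (simp add: m_def)
  define p where "p = c + m - t"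
  define q where "q = d - m - t"
  have pq: "p < q"
    using cd(1) by (simp add: p_def q_def m_def field_simps)
  define S where "S = {y \<in> I. y \<noteq> t \<and> \<bar>y - t\<bar> < m}"
  define quot where "quot y = (f y - f t) /\<^sub>R (y - t)" for y
  define Q where "Q y h = (forward_difference h f y - forward_difference h f t) /\<^sub>R (y - t)" for y h
  have in_cd: "c \<le> t + h \<and> t + h \<le> d \<and> c \<le> y + h \<and> y + h \<le> d" if "h \<in> {p..q}" "y \<in> S" for y h
    using that \<open>m > 0\<close> by (auto simp: S_def p_def q_def)
  have tpq: "t + h \<in> I \<and> \<bar>h\<bar> \<le> \<epsilon>" if "h \<in> {p..q}" for h
    using that \<open>m > 0\<close> cdI[of "t + h"] cd(3)[of "t + h"] by (auto simp: p_def q_def)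
  have "\<exists>g. ((\<lambda>y. Q y h) \<longlongrightarrow> g) (at t within S)" if h: "h \<in> {p..q}" for h
  proof -
    obtain g where "(forward_difference h f has_vector_derivative g) (at t within {t \<in> I. t + h \<in> I})"
      using diff tpq[OF h] by blast
    then have "(forward_difference h f has_vector_derivative g) (at t within S)"
      by (rule has_vector_derivative_within_subset) (use in_cd[OF h] cdI in \<open>auto simp: S_def\<close>)
    then show ?thesis
      unfolding has_vector_derivative_within_iff_quotient Q_def by blast
  qed
  then obtain g where g: "\<And>h. h \<in> {p..q} \<Longrightarrow> ((\<lambda>y. Q y h) \<longlongrightarrow> g h) (at t within S)"
    by metis
  have Q_cont: "continuous_on {p..q} (Q y)" if "y \<in> S" for y
  proof -
    have "continuous_on {p..q} (\<lambda>h. f (y + h))" "continuous_on {p..q} (\<lambda>h. f (t + h))"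
      using in_cd[OF _ that] cdI by (auto intro!: continuous_on_compose2[OF f] continuous_intros)
    then show ?thesis
      unfolding Q_def forward_difference_def by (intro continuous_intros)
  qed
  \<comment> \<open>each \<open>F M\<close> is closed, being cut out by conditions that are continuous in \<open>h\<close>; they cover since \<open>Q y h\<close> converges as \<open>y \<rightarrow> t\<close>\<close>
  define F where "F M = {h \<in> {p..q}. \<forall>y\<in>S. \<bar>y - t\<bar> < 1 / real (Suc M) \<longrightarrow> norm (Q y h) \<le> real M}" for M
  have "closed (F M)" for M
  proof -
    have "closed ({p..q} \<inter> (\<lambda>h. norm (Q y h)) -` {..real M})" if "y \<in> S" for y
      by (intro continuous_closed_preimage continuous_on_norm Q_cont that) auto
    then have "closed ({p..q} \<inter> (\<Inter>y\<in>{y\<in>S. \<bar>y - t\<bar> < 1 / real (Suc M)}. {p..q} \<inter> (\<lambda>h. norm (Q y h)) -` {..real M}))"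
      by (intro closed_Int closed_INT) auto
    moreover have "F M = {p..q} \<inter> (\<Inter>y\<in>{y\<in>S. \<bar>y - t\<bar> < 1 / real (Suc M)}. {p..q} \<inter> (\<lambda>h. norm (Q y h)) -` {..real M})"
      by (auto simp: F_def)
    ultimately show ?thesis
      by metis
  qed
  moreover have "{p..q} \<subseteq> (\<Union>M. F M)"
  proof
    fix h assume h: "h \<in> {p..q}"
    have "\<forall>\<^sub>F y in at t within S. norm (Q y h) < norm (g h) + 1"
      by (rule order_tendstoD(2)[OF tendsto_norm[OF g[OF h]]]) simp
    then obtain r where r: "r > 0" "\<And>y. y \<in> S \<Longrightarrow> \<bar>y - t\<bar> < r \<Longrightarrow> norm (Q y h) < norm (g h) + 1"
      unfolding eventually_at by (auto simp: dist_real_def S_def)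
    obtain M :: nat where M: "max (1/r) (norm (g h) + 1) < real M"
      using reals_Archimedean2 by blast
    have "1 / real (Suc M) < r"
      using M r(1) by (auto simp: field_simps intro: less_trans)
    then have "h \<in> F M"
      using h r(2) M by (fastforce simp: F_def)
    then show "h \<in> (\<Union>M. F M)"
      by blast
  qed
  ultimately obtain M p' q' where pq': "p' < q'" "{p'..q'} \<subseteq> {p..q}" "{p'..q'} \<subseteq> F M"
    using closed_cover_contains_interval[OF pq, of F] by metis
  define S' where "S' = {y \<in> S. \<bar>y - t\<bar> < 1 / real (Suc M)}"
  have p'q': "p' \<in> {p..q}" "q' \<in> {p..q}"
    using pq'(1,2) by auto
  define B where "B y = (integral {p' + y..q' + y} f - integral {p' + t..q' + t} f) /\<^sub>R (y - t)" for y
  have B_lim: "(B \<longlongrightarrow> f (t + q') - f (t + p')) (at t within S')"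
  proof -
    define P where "P x = integral {c..x} f" for x
    have contcd: "continuous_on {c..d} f"
      using f by (rule continuous_on_subset) (use cdI in auto)
    have P: "(P has_vector_derivative f x) (at x)" if "c < x" "x < d" for x
    proof -
      have "(P has_vector_derivative f x) (at x within {c..d})"
        unfolding P_def by (rule integral_has_vector_derivative[OF contcd]) (use that in auto)
      then show ?thesis
        by (simp only: at_within_Icc_at[OF that])
    qed
    have B_eq: "integral {p' + y..q' + y} f = P (q' + y) - P (p' + y)" if "y \<in> insert t S'" for y
    proof -
      have "\<bar>y - t\<bar> < m"
        using that \<open>m > 0\<close> unfolding S'_def S_def by force
      then have *: "c \<le> p' + y" "q' + y \<le> d"
        using p'q' unfolding p_def q_def atLeastAtMost_iff by linarith+
      have "P (p' + y) + integral {p' + y..q' + y} f = P (q' + y)"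
        unfolding P_def
      proof (rule Henstock_Kurzweil_Integration.integral_combine)
        show "f integrable_on {c..q' + y}"
          by (rule integrable_continuous_interval[OF continuous_on_subset[OF contcd]]) (use * in simp)
      qed (use * pq'(1) in simp_all)
      then show ?thesis
        by (metis add_diff_cancel_left')
    qed
    have "c < p' + t" "p' + t < d" "c < q' + t" "q' + t < d"
      using p'q' \<open>m > 0\<close> unfolding p_def q_def atLeastAtMost_iff by linarith+
    then have "(P has_vector_derivative f (p' + t)) (at (p' + t))" "(P has_vector_derivative f (q' + t)) (at (q' + t))"
      using P by blast+
    moreover have "((\<lambda>y. P (w + y)) has_vector_derivative f (w + t)) (at t)"
      if "(P has_vector_derivative f (w + t)) (at (w + t))" for w
    proof -
      have "((\<lambda>y. w + y) has_vector_derivative 1) (at t)"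
        by (auto intro!: derivative_eq_intros)
      from vector_diff_chain_at[OF this that] show ?thesis
        by (simp add: o_def)
    qed
    ultimately have "((\<lambda>y. P (q' + y) - P (p' + y)) has_vector_derivative f (q' + t) - f (p' + t)) (at t)"
      by (intro has_vector_derivative_diff)
    then have "((\<lambda>y. P (q' + y) - P (p' + y)) has_vector_derivative f (q' + t) - f (p' + t)) (at t within S')"
      by (rule has_vector_derivative_at_within)
    then have "((\<lambda>y. ((P (q' + y) - P (p' + y)) - (P (q' + t) - P (p' + t))) /\<^sub>R (y - t)) \<longlongrightarrow> f (q' + t) - f (p' + t)) (at t within S')"
      by (simp add: has_vector_derivative_within_iff_quotient)
    then have "(B \<longlongrightarrow> f (q' + t) - f (p' + t)) (at t within S')"
      by (rule Lim_transform_eventually) (auto simp: eventually_at_filter B_def B_eq)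
    then show ?thesis
      by (simp add: add.commute)
  qed
  have Q_int: "(q' - p') *\<^sub>R quot y = B y - integral {p'..q'} (Q y)" if "y \<in> S'" for y
  proof -
    have y: "y \<in> S"
      using that by (simp add: S'_def)
    have conts: "continuous_on {p'..q'} (\<lambda>h. f (h + y))" "continuous_on {p'..q'} (\<lambda>h. f (h + t))"
      using in_cd[OF _ y] cdI pq'(2) by (auto intro!: continuous_on_compose2[OF f] continuous_intros simp: add.commute)
    have "integral {p'..q'} (Q y) = integral {p'..q'} (\<lambda>h. (f (h + y) - f (h + t)) /\<^sub>R (y - t) - quot y)"
      by (rule integral_cong) (simp add: Q_def quot_def forward_difference_def algebra_simps flip: scaleR_diff_right)
    also have "\<dots> = integral {p'..q'} (\<lambda>h. (f (h + y) - f (h + t)) /\<^sub>R (y - t)) - integral {p'..q'} (\<lambda>h. quot y)"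
      by (intro Henstock_Kurzweil_Integration.integral_diff integrable_continuous_interval continuous_intros conts)
    also have "integral {p'..q'} (\<lambda>h. (f (h + y) - f (h + t)) /\<^sub>R (y - t)) =
        (integral {p'..q'} (\<lambda>h. f (h + y)) - integral {p'..q'} (\<lambda>h. f (h + t))) /\<^sub>R (y - t)"
      by (subst integral_cmul, subst Henstock_Kurzweil_Integration.integral_diff)
         (auto intro!: integrable_continuous_interval conts)
    also have "\<dots> = B y"
      using integral_shift_real_ivl[of "p' + y" y "q' + y" f] integral_shift_real_ivl[of "p' + t" t "q' + t" f]
      by (simp add: B_def)
    finally show ?thesis
      using pq'(1) by simp
  qed
  \<comment> \<open>along any two sequences the terms \<open>B\<close> have the same limit and the integrals of \<open>Q\<close> merge\<close>
  have "\<exists>L. (quot \<longlongrightarrow> L) (at t within S')"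
  proof (rule tendsto_within_if_sequences_merge)
    fix y z :: "nat \<Rightarrow> real"
    assume y: "\<And>n. y n \<in> S' - {t}" "y \<longlonglongrightarrow> t" and z: "\<And>n. z n \<in> S' - {t}" "z \<longlonglongrightarrow> t"
    have "filterlim w (at t within S) sequentially" "filterlim w (at t within S') sequentially"
      if "\<And>n. w n \<in> S' - {t}" "w \<longlonglongrightarrow> t" for w :: "nat \<Rightarrow> real"
      using that by (auto simp: filterlim_at S'_def)
    note at_t = this[OF y] this[OF z]
    have lims: "(\<lambda>n. B (y n) - B (z n)) \<longlonglongrightarrow> (f (t + q') - f (t + p')) - (f (t + q') - f (t + p'))"
      by (intro tendsto_diff filterlim_compose[OF B_lim] at_t)
    have ints: "(\<lambda>n. integral {p'..q'} (Q (y n)) - integral {p'..q'} (Q (z n))) \<longlonglongrightarrow> 0"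
    proof (rule integral_diff_tendsto_0)
      show "continuous_on {p'..q'} (Q (y n))" "continuous_on {p'..q'} (Q (z n))" for n
        using y(1)[of n] z(1)[of n] by (auto intro!: continuous_on_subset[OF Q_cont pq'(2)] simp: S'_def)
      show "norm (Q (y n) h) \<le> real M" "norm (Q (z n) h) \<le> real M" if "h \<in> {p'..q'}" for n h
        using y(1)[of n] z(1)[of n] subsetD[OF pq'(3) that] by (auto simp: F_def S'_def)
      show "(\<lambda>n. Q (y n) h) \<longlonglongrightarrow> g h" "(\<lambda>n. Q (z n) h) \<longlonglongrightarrow> g h" if "h \<in> {p'..q'}" for h
        using filterlim_compose[OF g at_t(1)] filterlim_compose[OF g at_t(3)] that pq'(2) by auto
    qed
    have "(\<lambda>n. ((B (y n) - B (z n)) - (integral {p'..q'} (Q (y n)) - integral {p'..q'} (Q (z n)))) /\<^sub>R (q' - p')) \<longlonglongrightarrow> 0"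
      using tendsto_scaleR[OF tendsto_const[of "inverse (q' - p')"] tendsto_diff[OF lims ints]]
      unfolding diff_self scaleR_zero_right .
    moreover have "((B (y n) - B (z n)) - (integral {p'..q'} (Q (y n)) - integral {p'..q'} (Q (z n)))) /\<^sub>R (q' - p')
        = quot (y n) - quot (z n)" for n
    proof -
      have yz: "y n \<in> S'" "z n \<in> S'"
        using y(1) z(1) by blast+
      have "(B (y n) - B (z n)) - (integral {p'..q'} (Q (y n)) - integral {p'..q'} (Q (z n)))
          = (B (y n) - integral {p'..q'} (Q (y n))) - (B (z n) - integral {p'..q'} (Q (z n)))"
        by (simp add: algebra_simps)
      also have "\<dots> = (q' - p') *\<^sub>R (quot (y n) - quot (z n))"
        by (simp only: scaleR_right_diff_distrib Q_int[OF yz(1)] Q_int[OF yz(2)])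
      finally have eq: "(B (y n) - B (z n)) - (integral {p'..q'} (Q (y n)) - integral {p'..q'} (Q (z n)))
          = (q' - p') *\<^sub>R (quot (y n) - quot (z n))" .
      have "inverse (q' - p') * (q' - p') = 1"
        using pq'(1) by simp
      then show ?thesis
        by (simp only: eq scaleR_scaleR scaleR_one)
    qed
    ultimately show "(\<lambda>n. quot (y n) - quot (z n)) \<longlonglongrightarrow> 0"
      by (simp only:)
  qed
  then obtain L where "(quot \<longlongrightarrow> L) (at t within S')"
    by blast
  moreover have "at t within S' = at t within I"
  proof (rule at_within_nhd[of t "ball t (min m (1 / real (Suc M)))"])
    show "S' \<inter> ball t (min m (1 / real (Suc M))) - {t} = I \<inter> ball t (min m (1 / real (Suc M))) - {t}"
      by (auto simp: S'_def S_def dist_real_def)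
  qed (use \<open>m > 0\<close> in auto)
  ultimately show ?thesis
    unfolding has_vector_derivative_within_iff_quotient quot_def by auto
qed

section \<open>Calculus of functions with continuous derivatives\<close>

lemma has_vector_derivative_shift_within:
  assumes f: "(f has_vector_derivative D) (at (t + c) within S)" and T: "\<And>u. u \<in> T \<Longrightarrow> u + c \<in> S"
  shows "((\<lambda>u. f (u + c)) has_vector_derivative D) (at t within T)"
proof -
  have "((\<lambda>u. u + c) has_vector_derivative 1) (at t within T)"
    by (auto intro!: derivative_eq_intros)
  moreover have "(f has_vector_derivative D) (at (t + c) within (\<lambda>u. u + c) ` T)"
    using f by (rule has_vector_derivative_within_subset) (use T in blast)
  ultimately show ?thesis
    using vector_diff_chain_within[of "\<lambda>u. u + c" 1 t T f D] by (simp add: o_def)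
qed

lemma Ck_on_imp_continuous_on:
  fixes f :: "real \<Rightarrow> 'a::real_normed_vector"
  assumes "Ck_on k S f"
  shows "continuous_on S f"
proof -
  obtain D :: "nat \<Rightarrow> real \<Rightarrow> 'a" where D: "\<forall>t\<in>S. D 0 t = f t" "\<forall>i\<le>k. continuous_on S (D i)"
    using assms unfolding Ck_on_def by blast
  have "continuous_on S (D 0)"
    using D(2) by blast
  then show ?thesis
    by (rule continuous_on_eq) (use D(1) in simp)
qed

lemma Ck_on_shift:
  assumes "Ck_on k S f" and T: "\<And>u. u \<in> T \<Longrightarrow> u + c \<in> S"
  shows "Ck_on k T (\<lambda>u. f (u + c))"
proof -
  obtain D where D: "\<And>t. t \<in> S \<Longrightarrow> D 0 t = f t"
      "\<And>i t. i < k \<Longrightarrow> t \<in> S \<Longrightarrow> (D i has_vector_derivative D (Suc i) t) (at t within S)"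
      "\<And>i. i \<le> k \<Longrightarrow> continuous_on S (D i)"
    using assms(1) unfolding Ck_on_def by blast
  show ?thesis
    unfolding Ck_on_def
  proof (intro exI[of _ "\<lambda>i u. D i (u + c)"] conjI ballI allI impI)
    show "continuous_on T (\<lambda>u. D i (u + c))" if "i \<le> k" for i
      by (rule continuous_on_compose2[OF D(3)[OF that]]) (use T in \<open>auto intro!: continuous_intros\<close>)
    show "((\<lambda>u. D i (u + c)) has_vector_derivative D (Suc i) (t + c)) (at t within T)" if "i < k" "t \<in> T" for i t
      by (rule has_vector_derivative_shift_within[OF D(2)[OF that(1)]]) (use T that in auto)
  qed (use D(1) T in auto)
qed

lemma Ck_on_minus:
  assumes "Ck_on k S f"
  shows "Ck_on k S (\<lambda>t. - f t)"
proof -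
  obtain D where D: "\<forall>t\<in>S. D 0 t = f t"
      "\<forall>i<k. \<forall>t\<in>S. (D i has_vector_derivative D (Suc i) t) (at t within S)"
      "\<forall>i\<le>k. continuous_on S (D i)"
    using assms(1) unfolding Ck_on_def by blast
  then show ?thesis
    unfolding Ck_on_def
    by (intro exI[of _ "\<lambda>i u. - D i u"]) (simp add: has_vector_derivative_minus continuous_on_minus)
qed

lemma Ck_on_zero: "Ck_on k S (\<lambda>t. 0)"
  unfolding Ck_on_def by (intro exI[of _ "\<lambda>i u. 0"]) simp

lemma Ck_on_SucI:
  assumes f: "\<And>t. t \<in> S \<Longrightarrow> (f has_vector_derivative f' t) (at t within S)" and "Ck_on k S f'"
  shows "Ck_on (Suc k) S f"
proof -
  obtain D where D: "\<forall>t\<in>S. D 0 t = f' t"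
      "\<forall>i<k. \<forall>t\<in>S. (D i has_vector_derivative D (Suc i) t) (at t within S)"
      "\<forall>i\<le>k. continuous_on S (D i)"
    using assms(2) unfolding Ck_on_def by blast
  have "continuous_on S f"
    using f by (rule continuous_on_vector_derivative)
  then show ?thesis
    using f D unfolding Ck_on_def
    by (intro exI[of _ "\<lambda>i. case i of 0 \<Rightarrow> f | Suc j \<Rightarrow> D j"])
       (auto split: nat.splits simp: less_Suc_eq_0_disj le_Suc_eq)
qed

text \<open>
  The first derivative that witnesses the hypothesis has to agree with \<open>f'\<close>, which requires that no
  point of \<open>S\<close> be isolated.
\<close>

lemma Ck_on_Suc_derivative:
  assumes "Ck_on (Suc k) S f" and f: "\<And>t. t \<in> S \<Longrightarrow> (f has_vector_derivative f' t) (at t within S)"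
    and S: "\<And>t. t \<in> S \<Longrightarrow> at t within S \<noteq> bot"
  shows "Ck_on k S f'"
proof -
  obtain D where D: "\<And>t. t \<in> S \<Longrightarrow> D 0 t = f t"
      "\<And>i t. i < Suc k \<Longrightarrow> t \<in> S \<Longrightarrow> (D i has_vector_derivative D (Suc i) t) (at t within S)"
      "\<And>i. i \<le> Suc k \<Longrightarrow> continuous_on S (D i)"
    using assms(1) unfolding Ck_on_def by blast
  have "D 1 t = f' t" if t: "t \<in> S" for t
  proof (rule vector_derivative_unique_within[OF S[OF t] _ f[OF t]])
    show "(f has_vector_derivative D 1 t) (at t within S)"
      by (rule has_vector_derivative_transform[OF t, where f = "D 0"]) (use D(1) D(2)[of 0] t in auto)
  qed
  then show ?thesis
    unfolding Ck_on_def using D(2,3) by (intro exI[of _ "\<lambda>i. D (Suc i)"]) auto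
qed

lemma Ck_on_Suc_imp_differentiable:
  assumes "Ck_on (Suc k) S f" "t \<in> S"
  shows "\<exists>g. (f has_vector_derivative g) (at t within S)"
proof -
  obtain D where D: "\<And>t. t \<in> S \<Longrightarrow> D 0 t = f t" "(D 0 has_vector_derivative D (Suc 0) t) (at t within S)"
    using assms unfolding Ck_on_def by (metis zero_less_Suc)
  then show ?thesis
    using has_vector_derivative_transform[OF assms(2), of f "D 0"] by metis
qed

text \<open>
  For negative \<open>h\<close>, \<open>\<Delta>\<^sub>h f (t) = - \<Delta>\<^bsub>-h\<^esub> f (t + h)\<close>.
\<close>

lemma Ck_on_forward_difference_abs:
  assumes diff: "\<And>h. 0 < h \<Longrightarrow> h \<le> \<epsilon> \<Longrightarrow> Ck_on k {t \<in> I. t + h \<in> I} (forward_difference h f)"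
    and h: "\<bar>h\<bar> \<le> \<epsilon>"
  shows "Ck_on k {t \<in> I. t + h \<in> I} (forward_difference h f)"
proof (cases h "0::real" rule: linorder_cases)
  case greater
  then show ?thesis
    using diff h by simp
next
  case equal
  then show ?thesis
    using Ck_on_zero by (simp add: forward_difference_def[abs_def])
next
  case less
  have "Ck_on k {t \<in> I. t + h \<in> I} (\<lambda>t. - forward_difference (- h) f (t + h))"
    by (intro Ck_on_minus Ck_on_shift[OF diff]) (use less h in auto)
  then show ?thesis
    by (simp add: forward_difference_def[abs_def])
qed

section \<open>Higher derivatives\<close>

text \<open>
  If \<open>\<bar>h\<bar>\<close> were the length of \<open>I\<close>, the domain of the difference could be a single point, where derivatives
  are not unique.
\<close>

lemma at_within_difference_domain_neq_bot:
  fixes I :: "real set"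
  assumes I: "is_interval I" "a \<in> I" "b \<in> I" and h: "\<bar>h\<bar> < b - a" and t: "t \<in> I" "t + h \<in> I"
  shows "at t within {t \<in> I. t + h \<in> I} \<noteq> bot"
proof -
  let ?J = "{t \<in> I. t + h \<in> I}"
  have "is_interval ?J"
    unfolding is_interval_1
  proof (intro ballI allI impI)
    fix u v x assume "u \<in> ?J" "v \<in> ?J" "u \<le> x \<and> x \<le> v"
    then show "x \<in> ?J"
      using mem_is_interval_1_I[OF I(1), of u v x] mem_is_interval_1_I[OF I(1), of "u + h" "v + h" "x + h"] by simp
  qed
  then have "connected ?J"
    by (simp add: is_interval_connected_1)
  moreover have "max a (a - h) \<in> ?J" "min b (b - h) \<in> ?J"
    using h by (auto intro!: mem_is_interval_1_I[OF I] simp: max_def min_def)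
  moreover have "max a (a - h) < min b (b - h)"
    using h by linarith
  ultimately have "t islimpt ?J"
    using t by (intro connected_imp_perfect) (blast, blast, metis less_irrefl singletonD)
  then show ?thesis
    by (simp add: trivial_limit_within)
qed

text \<open>
  The derivative is the limit of the difference quotients with increments \<open>s n\<close>, which are continuous
  in the base point.
\<close>

lemma lusin_on_derivative:
  fixes f :: "real \<Rightarrow> 'a::real_normed_vector"
  assumes f: "\<And>t. t \<in> I \<Longrightarrow> (f has_vector_derivative f' t) (at t within I)" and cd: "{c..d} \<subseteq> interior I"
  shows "lusin_on {c..d} f'"
proof -
  obtain r where r: "r > 0" "(\<Union>x\<in>{c..d}. ball x r) \<subseteq> interior I"
    using compact_subset_open_imp_ball_epsilon_subset[of "{c..d}" "interior I"] cd by auto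
  have I: "x + s \<in> I" if "x \<in> {c..d}" "\<bar>s\<bar> < r" for x s
    using r(2) that interior_subset[of I] by (force simp: dist_real_def)
  define s where "s n = r / real (Suc (Suc n))" for n
  have s: "s n > 0" "\<bar>s n\<bar> < r" for n
    using r(1) by (auto simp: s_def field_simps intro: add_pos_nonneg)
  have s0: "s \<longlonglongrightarrow> 0"
  proof -
    have "(\<lambda>n. r * inverse (real (Suc (Suc n)))) \<longlonglongrightarrow> r * 0"
      by (intro tendsto_mult tendsto_const LIMSEQ_Suc[OF LIMSEQ_inverse_real_of_nat])
    then show ?thesis
      by (simp add: s_def[abs_def] divide_inverse)
  qed
  have contf: "continuous_on I f"
    using f by (rule continuous_on_vector_derivative)
  show ?thesis
  proof (rule lusin_on_AE_limit[where N = "{}" and s = "\<lambda>n x. (f (x + s n) - f x) /\<^sub>R s n"])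
    show "lusin_on {c..d} (\<lambda>x. (f (x + s n) - f x) /\<^sub>R s n)" for n
    proof -
      have "(\<lambda>x. x + s n) ` {c..d} \<subseteq> I" "{c..d} \<subseteq> I"
        using I s(2) cd interior_subset[of I] by blast+
      then have "continuous_on {c..d} (\<lambda>x. f (x + s n))" "continuous_on {c..d} f"
        by (auto intro!: continuous_on_compose2[OF contf] continuous_on_subset[OF contf] continuous_intros)
      then show ?thesis
        by (intro lusin_on_continuous compact_Icc continuous_on_scaleR continuous_on_const continuous_on_diff)
    qed
    show "(\<lambda>n. (f (x + s n) - f x) /\<^sub>R s n) \<longlonglongrightarrow> f' x" if "x \<in> {c..d} - {}" for x
    proof -
      have x: "x \<in> {c..d}"
        using that by simp
      have "((\<lambda>y. (f y - f x) /\<^sub>R (y - x)) \<longlongrightarrow> f' x) (at x within I)"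
        using f[of x] I[OF x, of 0] r(1) by (simp add: has_vector_derivative_within_iff_quotient)
      moreover have "filterlim (\<lambda>n. x + s n) (at x within I) sequentially"
      proof -
        have "(\<lambda>n. x + s n) \<longlonglongrightarrow> x"
          using tendsto_add[OF tendsto_const s0, of x] by simp
        moreover have "\<And>n. x + s n \<in> I" "\<And>n. x + s n \<noteq> x"
          using I[OF x s(2)] s(1) by (auto simp: less_imp_neq[symmetric])
        ultimately show ?thesis
          by (simp add: filterlim_at)
      qed
      ultimately have "(\<lambda>n. (f (x + s n) - f x) /\<^sub>R (x + s n - x)) \<longlonglongrightarrow> f' x"
        by (rule filterlim_compose)
      then show ?thesis
        by simp
    qed
  qed auto
qed

lemma Ck_on_if_differences_Ck_on:
  fixes f :: "real \<Rightarrow> 'a::banach"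
  assumes I: "is_interval I" "a \<in> I" "b \<in> I" "a < b" and \<epsilon>: "0 < \<epsilon>" "\<epsilon> < b - a"
    and "continuous_on I f"
    and "\<And>h. \<bar>h\<bar> \<le> \<epsilon> \<Longrightarrow> Ck_on k {t \<in> I. t + h \<in> I} (forward_difference h f)"
  shows "Ck_on k I f"
  using assms(7,8)
proof (induction k arbitrary: f)
  case 0
  then show ?case
    unfolding Ck_on_def by (intro exI[of _ "\<lambda>i. f"]) auto
next
  case (Suc k)
  have "\<exists>L. (f has_vector_derivative L) (at t within I)" if t: "t \<in> I" for t
    by (rule differentiable_if_differences_differentiable[OF I \<epsilon>(1) t Suc.prems(1)])
       (intro Ck_on_Suc_imp_differentiable[OF Suc.prems(2)], use t in auto)
  then obtain f' where f': "\<And>t. t \<in> I \<Longrightarrow> (f has_vector_derivative f' t) (at t within I)"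
    by metis
  have diff: "Ck_on k {t \<in> I. t + h \<in> I} (forward_difference h f')" if h: "\<bar>h\<bar> \<le> \<epsilon>" for h
  proof (rule Ck_on_Suc_derivative[OF Suc.prems(2)[OF h]])
    fix t assume t: "t \<in> {t \<in> I. t + h \<in> I}"
    show "at t within {t \<in> I. t + h \<in> I} \<noteq> bot"
      by (rule at_within_difference_domain_neq_bot[OF I(1-3)]) (use h \<epsilon> t in auto)
    have "(f has_vector_derivative f' t) (at t within {t \<in> I. t + h \<in> I})"
      by (rule has_vector_derivative_within_subset[OF f']) (use t in auto)
    moreover have "((\<lambda>u. f (u + h)) has_vector_derivative f' (t + h)) (at t within {t \<in> I. t + h \<in> I})"
      by (rule has_vector_derivative_shift_within[OF f']) (use t in auto)
    ultimately show "(forward_difference h f has_vector_derivative forward_difference h f' t) (at t within {t \<in> I. t + h \<in> I})"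
      unfolding forward_difference_def[abs_def] by (intro has_vector_derivative_diff)
  qed
  have "continuous_on I f'"
    by (rule continuous_on_if_differences_continuous[OF I \<epsilon>(1) Ck_on_imp_continuous_on[OF diff]])
       (use lusin_on_derivative[OF f'] in auto)
  from Suc.IH[OF this diff] have "Ck_on k I f'" .
  with f' show ?case
    by (rule Ck_on_SucI)
qed

section \<open>Intervals with extended real endpoints\<close>

lemma real_interval_nondegenerate:
  assumes "\<alpha> < \<beta>"
  obtains a b where "a < b" "a \<in> real_interval lc rc \<alpha> \<beta>" "b \<in> real_interval lc rc \<alpha> \<beta>"
proof -
  obtain b where b: "\<alpha> < ereal b" "ereal b < \<beta>"
    using ereal_dense2[OF assms] by (elim exE conjE)
  obtain a where "\<alpha> < ereal a" "ereal a < ereal b"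
    using ereal_dense2[OF b(1)] by (elim exE conjE)
  moreover have "ereal a < \<beta>"
    using \<open>ereal a < ereal b\<close> b(2) by (rule less_trans)
  ultimately show ?thesis
    using b by (intro that[of a b]) (simp_all add: real_interval_def less_imp_le)
qed

lemma is_interval_real_interval: "is_interval (real_interval lc rc \<alpha> \<beta>)"
  unfolding is_interval_1
proof (intro ballI allI impI)
  fix u v x
  assume uv: "u \<in> real_interval lc rc \<alpha> \<beta>" "v \<in> real_interval lc rc \<alpha> \<beta>" and "u \<le> x \<and> x \<le> v"
  then have "ereal u \<le> ereal x" "ereal x \<le> ereal v"
    by simp_all
  with uv show "x \<in> real_interval lc rc \<alpha> \<beta>"
    unfolding real_interval_def mem_Collect_eq
    by (metis le_less_trans less_le_trans order_trans)
qed

theorem proposition1p5: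
  fixes \<phi> :: "real \<Rightarrow> 'a::banach" and \<alpha> \<beta> :: ereal and lc rc :: bool
    and \<epsilon>\<^sub>0 :: real and k :: nat
  assumes "\<alpha> < \<beta>" and "\<epsilon>\<^sub>0 > 0"
    and "L1_loc (real_interval lc rc \<alpha> \<beta>) \<phi>"
    and "\<forall>h\<in>{0<..\<epsilon>\<^sub>0}. Ck_on k (real_interval_shrink lc rc \<alpha> \<beta> h) (forward_difference h \<phi>)"
  shows "Ck_on k (real_interval lc rc \<alpha> \<beta>) \<phi>"
proof -
  let ?I = "real_interval lc rc \<alpha> \<beta>"
  obtain a b where ab: "a < b" "a \<in> ?I" "b \<in> ?I"
    using real_interval_nondegenerate[OF assms(1)] .
  note I = is_interval_real_interval ab(2,3,1)
  \<comment> \<open>the bound on \<open>h\<close> is lowered below the length of the interval, where differences live on nondegenerate intervals\<close>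
  define \<epsilon> where "\<epsilon> = min \<epsilon>\<^sub>0 ((b - a) / 2)"
  have "\<epsilon> \<le> (b - a) / 2"
    unfolding \<epsilon>_def by (rule min.cobounded2)
  with ab(1) have \<epsilon>_length: "\<epsilon> < b - a"
    by simp
  have \<epsilon>: "0 < \<epsilon>" "\<epsilon> \<le> \<epsilon>\<^sub>0"
    using ab(1) assms(2) by (simp_all add: \<epsilon>_def)
  have "Ck_on k {t \<in> ?I. t + h \<in> ?I} (forward_difference h \<phi>)" if "0 < h" "h \<le> \<epsilon>" for h
  proof -
    have "real_interval_shrink lc rc \<alpha> \<beta> h = {t \<in> ?I. t + h \<in> ?I}"
      using that(1) by (intro set_eqI) (simp add: real_interval_shrink_iff)
    moreover have "h \<in> {0<..\<epsilon>\<^sub>0}"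
      using that \<epsilon>(2) by simp
    ultimately show ?thesis
      using bspec[OF assms(4), of h] by simp
  qed
  then have diff: "Ck_on k {t \<in> ?I. t + h \<in> ?I} (forward_difference h \<phi>)" if "\<bar>h\<bar> \<le> \<epsilon>" for h
    using that by (rule Ck_on_forward_difference_abs)
  have diff_cont: "continuous_on {t \<in> ?I. t + h \<in> ?I} (forward_difference h \<phi>)" if "\<bar>h\<bar> \<le> \<epsilon>" for h
    using diff[OF that] by (rule Ck_on_imp_continuous_on)
  have lusin: "lusin_on {c..d} \<phi>" if "{c..d} \<subseteq> interior ?I" for c d
    using assms(3) that interior_subset[of ?I] unfolding L1_loc_def
    by (intro bochner_integrable_imp_lusin_on) auto
  have "continuous_on ?I \<phi>"
    by (rule continuous_on_if_differences_continuous[OF I \<epsilon>(1)]) (erule diff_cont, erule lusin)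
  then show ?thesis
    using diff by (rule Ck_on_if_differences_Ck_on[OF I \<epsilon>(1) \<epsilon>_length])
qed

end
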